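(* There are no diregular $(2,k,+2)$-digraphs for any integer $k\geq 3$.
   Context: All digraphs are finite. A digraph is $k$-geodetic if for all vertices $x,y$ (possibly equal) there is at most one directed walk of length at most $k$ from $x$ to $y$, where for $x=y$ the trivial walk of length $0$ is counted (so there are no loops, no multiple arcs, and no directed cycles of length at most $k$). Let $M(2,k)=1+2+2^2+\dots+2^k$. A $(2,k,+2)$-digraph is a $k$-geodetic digraph in which every vertex has out-degree at least $2$ and which has exactly $M(2,k)+2$ vertices. Such a digraph is called diregular if every vertex has in-degree and out-degree equal to $2$. *)

theory Defs
  imports "Graph_Theory.Arc_Walk"
begin

(* Walks are lists of arcs, so parallel arcs are distinct walks of length 1, and the empty list is
   the trivial walk from x to x. For k >= 1 this therefore rules out loops, parallel arcs and
   directed cycles of length at most k, and none of these has to be excluded separately. *)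
definition k_geodetic :: "nat \<Rightarrow> ('a, 'b) pre_digraph \<Rightarrow> bool" where
  "k_geodetic k G \<longleftrightarrow>
    (\<forall>x \<in> verts G. \<forall>y \<in> verts G. \<forall>p q.
      pre_digraph.awalk G x p y \<and> length p \<le> k \<and>
      pre_digraph.awalk G x q y \<and> length q \<le> k \<longrightarrow> p = q)"

definition moore_bound :: "nat \<Rightarrow> nat \<Rightarrow> nat" where
  "moore_bound d k = (\<Sum>i = 0..k. d ^ i)"

(* excess_digraph d k e G says that G is a (d,k,+e)-digraph. *)
definition excess_digraph :: "nat \<Rightarrow> nat \<Rightarrow> nat \<Rightarrow> ('a, 'b) pre_digraph \<Rightarrow> bool" where
  "excess_digraph d k e G \<longleftrightarrow>
    fin_digraph G \<and> k_geodetic k G \<and>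
    (\<forall>v \<in> verts G. d \<le> out_degree G v) \<and>
    card (verts G) = moore_bound d k + e"

definition diregular :: "nat \<Rightarrow> ('a, 'b) pre_digraph \<Rightarrow> bool" where
  "diregular d G \<longleftrightarrow> (\<forall>v \<in> verts G. in_degree G v = d \<and> out_degree G v = d)"

end

theory Submission
  imports Defs
begin

text \<open>
  The order \<open>2 ^ (k + 1) + 1\<close> is odd, so the vertices cannot be partitioned into pairs with equal
  out-neighbourhoods; as all degrees are two, some vertices \<open>u \<rightarrow> u1, w\<close> and \<open>v \<rightarrow> v1, w\<close> share exactly
  one out-neighbour. Call this a fork, and call the two vertices not reached from \<open>u\<close> within \<open>k\<close>
  steps the outliers of \<open>u\<close>. The trees of depth \<open>k - 1\<close> below \<open>u1\<close> and \<open>v1\<close> each cover the complement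
  of the tree below \<open>w\<close> up to three vertices, so they nearly coincide. Hence \<open>v\<close> is an outlier of \<open>u\<close>
  or sits on the last level below \<open>u1\<close>, and vice versa. In each of the resulting cases \<open>u1\<close> and \<open>v1\<close>
  are forced to share an out-neighbour unless uniqueness of short walks fails at once, and then
  either an outlier of \<open>u\<close> or the second in-neighbour of \<open>u1\<close> gives a contradiction.
\<close>

section \<open>Layers of descendants and the abstract setting\<close>

fun layer :: "('a \<Rightarrow> 'a set) \<Rightarrow> nat \<Rightarrow> 'a \<Rightarrow> 'a set" where
  "layer N 0 x = {x}"
| "layer N (Suc n) x = (\<Union>y \<in> N x. layer N n y)"

lemma layer_trans: "y \<in> layer N i x \<Longrightarrow> z \<in> layer N j y \<Longrightarrow> z \<in> layer N (i + j) x"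
  by (induction i arbitrary: x) auto

text \<open>\<open>no_cycle\<close> and \<open>diverge\<close> express \<open>k\<close>-geodecity
  through layers; the bounds in \<open>diverge\<close> are strict because the arc out of
  \<open>x\<close> adds one to each length. The order is \<open>M(2,k) + 2\<close>.\<close>

locale geodetic_excess_two =
  fixes V :: "'a set" and N :: "'a \<Rightarrow> 'a set" and k :: nat
  assumes finite_V: "finite V"
    and N_sub: "x \<in> V \<Longrightarrow> N x \<subseteq> V"
    and card_N: "x \<in> V \<Longrightarrow> card (N x) = 2"
    and card_parents: "x \<in> V \<Longrightarrow> card {u \<in> V. x \<in> N u} = 2"
    and card_V: "card V = 2 ^ (k + 1) + 1"
    and k_ge: "3 \<le> k"
    and no_cycle: "x \<in> V \<Longrightarrow> 0 < j \<Longrightarrow> j \<le> k \<Longrightarrow> x \<notin> layer N j x"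
    and diverge: "x \<in> V \<Longrightarrow> p \<in> N x \<Longrightarrow> q \<in> N x \<Longrightarrow> p \<noteq> q \<Longrightarrow> i < k \<Longrightarrow> j < k \<Longrightarrow>
      layer N i p \<inter> layer N j q = {}"
begin

abbreviation "L \<equiv> layer N"

definition outliers :: "'a \<Rightarrow> 'a set" where
  "outliers x = V - (\<Union>i\<le>k. L i x)"

definition fork :: "'a \<Rightarrow> 'a \<Rightarrow> 'a \<Rightarrow> 'a \<Rightarrow> 'a \<Rightarrow> bool" where
  "fork u v w u1 v1 \<longleftrightarrow> u \<in> V \<and> v \<in> V \<and> u \<noteq> v \<and> N u = {u1, w} \<and> N v = {v1, w} \<and>
     u1 \<noteq> w \<and> v1 \<noteq> w \<and> u1 \<noteq> v1"

lemma fork_sym: "fork u v w u1 v1 \<Longrightarrow> fork v u w v1 u1"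
  by (auto simp: fork_def)

section \<open>Uniqueness of depth and counting\<close>

lemma finite_N: "x \<in> V \<Longrightarrow> finite (N x)"
  using N_sub finite_V finite_subset by blast

lemma layer_sub: "x \<in> V \<Longrightarrow> L n x \<subseteq> V"
proof (induction n arbitrary: x)
  case (Suc n)
  then show ?case using N_sub by fastforce
qed auto

lemma step_right: "y \<in> L i x \<Longrightarrow> z \<in> N y \<Longrightarrow> z \<in> L (Suc i) x"
  using layer_trans[of y N i x z 1] by auto

text \<open>By \<open>diverge\<close>, two short nontrivial walks to the same vertex share their
  first step; peeling off steps leaves equal lengths or a short cycle.\<close>

lemma layer_le_unique:
  "x \<in> V \<Longrightarrow> i \<le> k \<Longrightarrow> j \<le> k \<Longrightarrow> y \<in> L i x \<Longrightarrow> y \<in> L j x \<Longrightarrow> i = j"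
proof (induction i arbitrary: x j)
  case 0
  then show ?case using no_cycle[of x j] by auto
next
  case (Suc i)
  show ?case
  proof (cases j)
    case 0
    then show ?thesis using Suc.prems no_cycle[of x "Suc i"] by auto
  next
    case (Suc j')
    obtain p q where pq: "p \<in> N x" "y \<in> L i p" "q \<in> N x" "y \<in> L j' q"
      using Suc.prems Suc by auto
    then have "p = q"
      using diverge[of x p q i j'] Suc.prems Suc by auto
    moreover have "p \<in> V"
      using pq N_sub Suc.prems by blast
    ultimately show ?thesis
      using Suc.IH[of p j'] pq Suc.prems Suc by auto
  qed
qed

lemma card_layer: "x \<in> V \<Longrightarrow> n \<le> k \<Longrightarrow> card (L n x) = 2 ^ n"
proof (induction n arbitrary: x)
  case (Suc n)
  have V: "y \<in> V" if "y \<in> N x" for y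
    using that N_sub Suc.prems by blast
  have "card (L (Suc n) x) = (\<Sum>y\<in>N x. card (L n y))"
    unfolding layer.simps
  proof (rule card_UN_disjoint)
    show "\<forall>i\<in>N x. finite (L n i)"
      using V layer_sub finite_V finite_subset by meson
    show "\<forall>i\<in>N x. \<forall>j\<in>N x. i \<noteq> j \<longrightarrow> L n i \<inter> L n j = {}"
      using diverge Suc.prems by auto
  qed (use finite_N Suc.prems in auto)
  also have "\<dots> = (\<Sum>y\<in>N x. 2 ^ n)"
    using Suc V by (intro sum.cong) auto
  finally show ?case
    using card_N Suc.prems by simp
qed auto

text \<open>The layers up to \<open>k\<close> are disjoint and double in size:
  \<open>2 ^ (k + 1) - 1\<close> vertices, two fewer than the order.\<close>

lemma card_outliers:
  assumes "x \<in> V"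
  shows "card (outliers x) = 2"
proof -
  have fin: "finite (L i x)" for i
    using layer_sub[OF assms] finite_V finite_subset by meson
  have "card (\<Union>i\<le>k. L i x) = (\<Sum>i\<le>k. card (L i x))"
    using fin layer_le_unique[OF assms] by (intro card_UN_disjoint) auto
  also have "\<dots> = (\<Sum>i\<le>k. 2 ^ i)"
    using card_layer[OF assms] by (intro sum.cong) auto
  also have "\<dots> = 2 ^ (k + 1) - 1"
    by (induction k) auto
  finally have "card (\<Union>i\<le>k. L i x) = 2 ^ (k + 1) - 1" .
  moreover have "(\<Union>i\<le>k. L i x) \<subseteq> V"
    using layer_sub[OF assms] by auto
  ultimately show ?thesis
    unfolding outliers_def using card_V finite_V
    by (subst card_Diff_subset) (auto intro: finite_subset)
qed

lemma finite_outliers: "finite (outliers x)"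
  unfolding outliers_def using finite_V by auto

lemma not_outlier: "y \<in> outliers x \<Longrightarrow> i \<le> k \<Longrightarrow> y \<notin> L i x"
  unfolding outliers_def by auto

lemma outliers_eq: "x \<in> V \<Longrightarrow> p \<in> outliers x \<Longrightarrow> q \<in> outliers x \<Longrightarrow> p \<noteq> q \<Longrightarrow> outliers x = {p, q}"
  using card_outliers[of x] finite_outliers[of x] card_subset_eq[of "outliers x" "{p, q}"] by auto

lemma ex_other_outlier:
  assumes "x \<in> V" "p \<in> outliers x"
  obtains q where "q \<noteq> p" "outliers x = {p, q}"
proof -
  obtain a b where "outliers x = {a, b}" "a \<noteq> b"
    using card_outliers[OF assms(1)] card_2_iff by metis
  then show ?thesis
    using that[of a] that[of b] assms(2) by auto
qed

lemma N_eq: "x \<in> V \<Longrightarrow> p \<in> N x \<Longrightarrow> q \<in> N x \<Longrightarrow> p \<noteq> q \<Longrightarrow> N x = {p, q}"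
  using card_N[of x] finite_N[of x] card_subset_eq[of "N x" "{p, q}"] by auto

lemma ex_other_child:
  assumes "x \<in> V" "p \<in> N x"
  obtains q where "q \<noteq> p" "N x = {p, q}"
proof -
  obtain a b where "N x = {a, b}" "a \<noteq> b"
    using card_N[OF assms(1)] card_2_iff by metis
  then show ?thesis
    using that[of a] that[of b] assms(2) by auto
qed

lemma ex_other_parent:
  assumes "x \<in> V" "u \<in> V" "x \<in> N u"
  obtains v where "v \<in> V" "v \<noteq> u" "x \<in> N v" "{z \<in> V. x \<in> N z} = {u, v}"
proof -
  obtain a b where "{z \<in> V. x \<in> N z} = {a, b}" "a \<noteq> b"
    using card_parents[OF assms(1)] card_2_iff by metis
  then show ?thesis
    using that assms(2,3) by (cases "u = a") blast+
qed

section \<open>Positions of \<open>v\<close>, \<open>v1\<close> and the out-neighbours of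
  \<open>v1\<close> in a fork\<close>

lemma fork_verts:
  assumes "fork u v w u1 v1"
  shows "u \<in> V" "v \<in> V" "w \<in> V" "u1 \<in> V" "v1 \<in> V"
  using assms N_sub[of u] N_sub[of v] by (auto simp: fork_def)

text \<open>Both sides of a fork cover the same set, namely everything not reached through the common
  out-neighbour \<open>w\<close>.\<close>
lemma fork_transfer:
  assumes f: "fork u v w u1 v1" and z: "z = v \<or> (\<exists>i<k. z \<in> L i v1)"
  shows "z = u \<or> z \<in> outliers u \<or> (\<exists>m<k. z \<in> L m u1)"
proof (rule ccontr)
  note V = fork_verts[OF f]
  assume neg: "\<not> ?thesis"
  have "z \<in> V"
    using z V layer_sub by blast
  then obtain j where j: "j \<le> k" "z \<in> L j u"
    using neg unfolding outliers_def by auto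
  then obtain m where m: "j = Suc m"
    using neg by (cases j) auto
  then have "z \<in> L m u1 \<or> z \<in> L m w"
    using j f by (auto simp: fork_def)
  \<comment> \<open>Only the tree below \<open>w\<close> remains. It misses \<open>v\<close> by
    \<open>no_cycle\<close> and the tree below \<open>v1\<close> by \<open>diverge\<close> at
    \<open>v\<close>.\<close>
  then have w: "z \<in> L m w"
    using neg m j by auto
  then have "z \<in> L (Suc m) v"
    using f by (auto simp: fork_def)
  then have "z \<noteq> v"
    using no_cycle[of v "Suc m"] V m j by auto
  then obtain i where "i < k" "z \<in> L i v1"
    using z by auto
  then show False
    using w diverge[of v v1 w i m] V f m j by (auto simp: fork_def)
qed

text \<open>If \<open>c\<close> is closer to \<open>v1\<close> than to \<open>u1\<close>, the descendants of \<open>c\<close> just below the last level of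
  the tree of \<open>u1\<close> must be covered by the at most three vertices outside that tree.\<close>
lemma fork_push:
  assumes f: "fork u v w u1 v1" and c: "c \<in> L r v1" "c \<in> L m u1" "r < m" "m < k"
  shows "m = k - 1 \<and> N c \<subseteq> insert u (outliers u)"
proof -
  note V = fork_verts[OF f]
  have cV: "c \<in> V"
    using c V layer_sub by blast
  have sub: "L (k - m) c \<subseteq> insert u (outliers u)"
  proof
    fix z assume z: "z \<in> L (k - m) c"
    have "z \<in> L (r + (k - m)) v1" "z \<in> L k u1"
      using layer_trans[OF c(1) z] layer_trans[OF c(2) z] c by auto
    moreover have "r + (k - m) < k"
      using c by auto
    ultimately have "z = u \<or> z \<in> outliers u \<or> (\<exists>m<k. z \<in> L m u1)"
      using fork_transfer[OF f] by blast
    moreover have "z \<notin> L j u1" if "j < k" for j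
      using that \<open>z \<in> L k u1\<close> layer_le_unique[OF V(4), of j k z] by auto
    ultimately show "z \<in> insert u (outliers u)"
      by auto
  qed
  have "2 ^ (k - m) \<le> card (insert u (outliers u))"
    using card_mono[OF _ sub] finite_outliers card_layer[OF cV, of "k - m"] by auto
  also have "\<dots> \<le> 3"
    using card_outliers[OF V(1)] finite_outliers by (auto simp: card_insert_if)
  finally have le: "(2::nat) ^ (k - m) \<le> 3" .
  have "k - m < 2"
  proof (rule ccontr)
    assume "\<not> k - m < 2"
    then have "(2::nat) ^ 2 \<le> 2 ^ (k - m)"
      by (intro power_increasing) auto
    then show False
      using le by simp
  qed
  then have 1: "m = k - 1" "k - m = Suc 0"
    using c by auto
  moreover have "L (Suc 0) c = N c"
    by auto
  ultimately show ?thesis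
    using sub by auto
qed

text \<open>If \<open>v1\<close> lies in the tree below \<open>u1\<close>, \<open>fork_push\<close>
  applies with \<open>r = 0\<close>. If \<open>v1 = u\<close>, then \<open>w\<close> is reached from
  \<open>v\<close> in one step and in two.\<close>

lemma fork_child_position:
  assumes f: "fork u v w u1 v1"
  shows "v1 \<in> outliers u \<or> v1 \<in> L (k - 1) u1 \<and> N v1 \<subseteq> insert u (outliers u)"
proof -
  note V = fork_verts[OF f]
  have "v1 \<in> L 0 v1"
    by simp
  then consider "v1 = u" | "v1 \<in> outliers u" | m where "m < k" "v1 \<in> L m u1"
    using fork_transfer[OF f, of v1] k_ge by (metis gr0I not_numeral_le_zero)
  then show ?thesis
  proof cases
    case 1
    then have "w \<in> L 1 v" "w \<in> L 2 v"
      using f by (auto simp: fork_def numeral_2_eq_2)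
    then show ?thesis
      using layer_le_unique[OF V(2), of 1 2 w] k_ge by auto
  next
    case 3
    then have "0 < m"
      using f by (cases m) (auto simp: fork_def)
    then show ?thesis
      using fork_push[OF f _ 3(2), of 0] 3 by auto
  qed auto
qed

text \<open>At a smaller depth below \<open>u1\<close>, the walk from \<open>u\<close> through
  \<open>v\<close> to \<open>w\<close> would have length at most \<open>k\<close> and compete with
  the arc from \<open>u\<close> to \<open>w\<close>.\<close>

lemma fork_root_position:
  assumes f: "fork u v w u1 v1"
  shows "v \<in> outliers u \<or> v \<in> L (k - 1) u1"
proof -
  note V = fork_verts[OF f]
  consider "v \<in> outliers u" | m where "m < k" "v \<in> L m u1"
    using fork_transfer[OF f, of v] f by (auto simp: fork_def)
  then show ?thesis
  proof cases
    case 2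
    have "v \<in> L (Suc m) u"
      using 2 f by (auto simp: fork_def)
    then have "w \<in> L (Suc (Suc m)) u"
      using f step_right[of v "Suc m" u w] by (auto simp: fork_def)
    moreover have "w \<in> L 1 u"
      using f by (auto simp: fork_def)
    ultimately have "\<not> Suc (Suc m) \<le> k"
      using layer_le_unique[OF V(1), of 1 "Suc (Suc m)" w] k_ge by auto
    then have "m = k - 1"
      using 2 by auto
    then show ?thesis
      using 2 by auto
  qed auto
qed

text \<open>\<open>fork_push\<close> with \<open>r = 1\<close> handles depths above 1 below
  \<open>u1\<close>; depths 0 and 1 remain as alternatives.\<close>

lemma fork_grandchild_position:
  assumes f: "fork u v w u1 v1" and c: "c \<in> N v1"
  shows "c = u \<or> c = u1 \<or> c \<in> outliers u \<or> c \<in> N u1 \<or>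
    c \<in> L (k - 1) u1 \<and> N c \<subseteq> insert u (outliers u)"
proof -
  have c1: "c \<in> L 1 v1"
    using c by auto
  then consider "c = u" | "c \<in> outliers u" | m where "m < k" "c \<in> L m u1"
    using fork_transfer[OF f, of c] k_ge by (metis One_nat_def Suc_le_lessD numeral_3_eq_3 Suc_leD)
  then show ?thesis
  proof cases
    case 3
    consider "m = 0" | "m = 1" | "1 < m"
      by linarith
    then show ?thesis
    proof cases
      case 3
      then show ?thesis
        using fork_push[OF f c1 \<open>c \<in> L m u1\<close>] \<open>m < k\<close> \<open>c \<in> L m u1\<close> by auto
    qed (use 3 in auto)
  qed auto
qed

lemma no_two_cycle: "x \<in> V \<Longrightarrow> y \<in> N x \<Longrightarrow> x \<notin> N y"
  using no_cycle[of x 2] k_ge by (auto simp: numeral_2_eq_2)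

text \<open>Here \<open>u\<close> and \<open>u'\<close> form another fork, to which the previous analysis of \<open>v1\<close> applies.\<close>
lemma fork_other_parent:
  assumes f: "fork u v w u1 v1" and a: "a \<in> N u1" "a \<in> N v1"
  obtains u' x where "u' \<in> V" "x \<in> V" "N u' = {x, u1}" "x \<noteq> u1"
    "x \<in> outliers u \<or> N x \<subseteq> insert u (outliers u)" "x \<noteq> v1" "v1 \<notin> N x"
proof -
  note V = fork_verts[OF f]
  have "u1 \<in> N u"
    using f by (auto simp: fork_def)
  then obtain u' where u': "u' \<in> V" "u' \<noteq> u" "u1 \<in> N u'"
    using ex_other_parent[OF V(4) V(1)] by metis
  obtain x where x: "x \<noteq> u1" "N u' = {u1, x}"
    using ex_other_child[OF u'(1) u'(3)] by metis
  \<comment> \<open>The in-neighbours of \<open>w\<close> are exactly \<open>u\<close> and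
    \<open>v\<close>, and \<open>u1\<close> is not an out-neighbour of \<open>v\<close>.\<close>
  have "x \<noteq> w"
  proof
    assume "x = w"
    have "{z \<in> V. w \<in> N z} = {u, v}"
    proof -
      have "w \<in> N u" "w \<in> N v"
        using f by (auto simp: fork_def)
      then show ?thesis
        using ex_other_parent[OF V(3) V(1)] V f unfolding fork_def
        by (smt (verit, best) insert_iff mem_Collect_eq singletonD)
    qed
    then have "u' = v"
      using u' x \<open>x = w\<close> by blast
    then show False
      using u' f by (auto simp: fork_def)
  qed
  \<comment> \<open>Here \<open>u1\<close> is the shared out-neighbour, and \<open>w\<close> and
    \<open>x\<close> play the roles of \<open>u1\<close> and \<open>v1\<close>;
    \<open>fork_child_position\<close> then locates \<open>x\<close>.\<close>
  then have f': "fork u u' u1 w x"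
    using f u' x by (auto simp: fork_def)
  have a2: "a \<in> L 1 u1"
    using a by auto
  \<comment> \<open>Since \<open>a\<close> has depth 1 below \<open>u1\<close>,
    \<open>diverge\<close> at \<open>u'\<close> keeps it out of the tree below
    \<open>x\<close>.\<close>
  have "x \<noteq> v1"
  proof
    assume "x = v1"
    then have "a \<in> L 1 x"
      using a by auto
    then show False
      using a2 diverge[OF u'(1), of u1 x 1 1] x k_ge by auto
  qed
  moreover have "v1 \<notin> N x"
  proof
    assume "v1 \<in> N x"
    then have "a \<in> L 2 x"
      using a by (auto simp: numeral_2_eq_2)
    then show False
      using a2 diverge[OF u'(1), of u1 x 1 2] x k_ge by auto
  qed
  ultimately show ?thesis
    using that[of u' x] fork_child_position[OF f'] fork_verts[OF f'] x u' by auto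
qed

section \<open>Excluding the three kinds of fork\<close>

lemma card_N_not_sub_singleton: "x \<in> V \<Longrightarrow> \<not> N x \<subseteq> {p}"
  using card_N[of x] card_mono[of "{p}" "N x"] by auto

text \<open>The outliers of \<open>u\<close> are \<open>v\<close> and \<open>v1\<close>, and
  \<open>v1\<close> shares an out-neighbour with \<open>u1\<close>. The second in-neighbour of
  \<open>u1\<close> then has an out-neighbour \<open>x\<close> with arcs to both \<open>u\<close>
  and \<open>v\<close>, so \<open>x\<close> reaches \<open>w\<close> twice.\<close>

lemma no_fork_mutual_outliers:
  assumes f: "fork u v w u1 v1" and vo: "v \<in> outliers u" and uo: "u \<in> outliers v"
  shows False
proof -
  have gen: "v1 \<in> outliers u"
    if f: "fork u v w u1 v1" and vo: "v \<in> outliers u" and uo: "u \<in> outliers v" for u v u1 v1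
  proof (rule ccontr)
    note V = fork_verts[OF f]
    assume "v1 \<notin> outliers u"
    then have sub: "N v1 \<subseteq> insert u (outliers u)"
      using fork_child_position[OF f] by auto
    obtain y where y: "outliers u = {v, y}"
      using ex_other_outlier[OF V(1) vo] by metis
    have "v1 \<in> N v"
      using f by (auto simp: fork_def)
    then have "v \<notin> N v1"
      using no_two_cycle V by auto
    moreover have "u \<notin> N v1"
    proof
      assume "u \<in> N v1"
      then have "u \<in> L 2 v"
        using \<open>v1 \<in> N v\<close> by (auto simp: numeral_2_eq_2)
      then show False
        using not_outlier[OF uo, of 2] k_ge by auto
    qed
    ultimately have "N v1 \<subseteq> {y}"
      using sub y by auto
    then show False
      using card_N_not_sub_singleton V by blast
  qed
  note V = fork_verts[OF f]
  have u1: "u1 \<in> N u" "w \<in> N u" and v1: "v1 \<in> N v" "w \<in> N v"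
    using f by (auto simp: fork_def)
  have v1o: "v1 \<in> outliers u" and u1o: "u1 \<in> outliers v"
    using gen[OF f vo uo] gen[OF fork_sym[OF f] uo vo] by auto
  have "v \<noteq> v1"
    using no_cycle[of v 1] V v1 k_ge by auto
  then have O: "outliers u = {v, v1}"
    using outliers_eq V vo v1o by auto
  obtain a where a: "a \<in> N v1"
    using card_N[OF V(5)] by fastforce
  have "a \<in> N u1"
  proof -
    have vn: "v \<notin> L 2 v" "v1 \<notin> L 1 v1" "v1 \<notin> L 2 v1"
      using no_cycle[OF V(2), of 2] no_cycle[OF V(5), of 1] no_cycle[OF V(5), of 2] k_ge by auto
    have 1: "a \<in> L 2 v"
      using a v1 by (auto simp: numeral_2_eq_2)
    have "a \<noteq> u" "a \<noteq> u1"
      using 1 not_outlier[OF uo, of 2] not_outlier[OF u1o, of 2] k_ge by auto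
    moreover have "a \<notin> outliers u"
      using 1 vn a O by auto
    \<comment> \<open>An out-neighbour of \<open>a\<close> has depth 2 below \<open>v1\<close> and
      depth 3 below \<open>v\<close>; as \<open>3 \<le> k\<close>, it is none of \<open>u\<close>,
      \<open>v\<close>, \<open>v1\<close>.\<close>
    moreover have "\<not> N a \<subseteq> insert u (outliers u)"
    proof
      assume sub: "N a \<subseteq> insert u (outliers u)"
      have "b \<noteq> v1 \<and> b \<noteq> v \<and> b \<noteq> u" if "b \<in> N a" for b
      proof -
        have "b \<in> L 2 v1"
          using that a by (auto simp: numeral_2_eq_2)
        moreover have "b \<in> L 3 v"
          using step_right[OF 1 that] by (simp add: numeral_3_eq_3 numeral_2_eq_2)
        ultimately show ?thesis
          using no_cycle[OF V(5), of 2] no_cycle[OF V(2), of 3] not_outlier[OF uo, of 3] k_ge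
          by auto
      qed
      then have "N a = {}"
        using sub O by auto
      moreover have "a \<in> V"
        using a N_sub V by auto
      ultimately show False
        using card_N[of a] by simp
    qed
    ultimately show ?thesis
      using fork_grandchild_position[OF f a] by auto
  qed
  then obtain u' x where x: "u' \<in> V" "x \<in> V" "N u' = {x, u1}" "x \<noteq> u1"
    "x \<in> outliers u \<or> N x \<subseteq> insert u (outliers u)" "x \<noteq> v1" "v1 \<notin> N x"
    using fork_other_parent[OF f _ a] by metis
  \<comment> \<open>\<open>x = v\<close> is impossible, since \<open>v1\<close> is in
    \<open>N v\<close> but not in \<open>N x\<close>.\<close>
  have "N x \<subseteq> {u, v}"
    using x O v1 by auto
  moreover have "card (N x) = card {u, v}"
    using f card_N[OF x(2)] by (auto simp: fork_def)
  ultimately have "N x = {u, v}"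
    by (intro card_subset_eq) auto
  moreover have "w \<in> L 1 u" "w \<in> L 1 v"
    using u1 v1 by auto
  ultimately show False
    using diverge[OF x(2), of u v 1 1] f k_ge by (auto simp: fork_def)
qed

text \<open>The arc from \<open>v\<close> puts \<open>v1\<close> at depth \<open>k\<close> below
  \<open>u1\<close>, so its depth there is not \<open>k - 1\<close>.\<close>

lemma fork_child_outlier:
  assumes f: "fork u v w u1 v1" and v: "v \<in> L (k - 1) u1"
  shows "v1 \<in> outliers u"
proof -
  note V = fork_verts[OF f]
  have "v1 \<in> L (Suc (k - 1)) u1"
    using v f by (intro step_right) (auto simp: fork_def)
  then have "v1 \<notin> L (k - 1) u1"
    using layer_le_unique[OF V(4), of "k - 1" "Suc (k - 1)" v1] k_ge by auto
  then show ?thesis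
    using fork_child_position[OF f] by auto
qed

lemma fork_root_not_grandchild:
  assumes f: "fork u v w u1 v1" and v: "v \<in> L (k - 1) u1"
  shows "v \<notin> N u1"
proof
  assume "v \<in> N u1"
  then have "v \<in> L 1 u1"
    by auto
  then show False
    using v layer_le_unique[OF fork_verts(4)[OF f], of 1 "k - 1" v] k_ge by auto
qed

text \<open>The outliers of \<open>v\<close> are \<open>u\<close> and \<open>u1\<close>, which
  forces \<open>N u1 = N v1\<close>. The outlier \<open>y\<close> of \<open>u\<close> other than
  \<open>v1\<close> is then reached from \<open>v\<close> neither through \<open>v1\<close> nor
  through \<open>w\<close>, yet it is no outlier of \<open>v\<close>.\<close>

lemma no_fork_one_outlier:
  assumes f: "fork u v w u1 v1" and v: "v \<in> L (k - 1) u1" and uo: "u \<in> outliers v"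
  shows False
proof -
  note V = fork_verts[OF f]
  note f' = fork_sym[OF f]
  have u1: "u1 \<in> N u" and v1: "v1 \<in> N v"
    using f by (auto simp: fork_def)
  have v1o: "v1 \<in> outliers u"
    using fork_child_outlier[OF f v] .
  have vn: "v \<notin> N u1"
    using fork_root_not_grandchild[OF f v] .
  have un: "u \<notin> N u1"
    using no_two_cycle[OF V(1) u1] .
  have u1o: "u1 \<in> outliers v"
  proof (rule ccontr)
    assume "u1 \<notin> outliers v"
    then have "N u1 \<subseteq> insert v (outliers v)"
      using fork_child_position[OF f'] by auto
    moreover obtain y where "outliers v = {u, y}"
      using ex_other_outlier[OF V(2) uo] by metis
    ultimately have "N u1 \<subseteq> {y}"
      using vn un by auto
    then show False
      using card_N_not_sub_singleton V by blast
  qed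
  have "u \<noteq> u1"
    using no_cycle[of u 1] V u1 k_ge by auto
  then have O: "outliers v = {u, u1}"
    using outliers_eq V uo u1o by auto
  have "a \<in> N v1" if a: "a \<in> N u1" for a
  proof -
    have aV: "a \<in> V"
      using a N_sub V by auto
    have 1: "a \<in> L 2 u"
      using a u1 by (auto simp: numeral_2_eq_2)
    have "a \<noteq> u1"
      using no_cycle[of u1 1] V a k_ge by auto
    moreover have "a \<noteq> v1"
      using 1 not_outlier[OF v1o, of 2] k_ge by auto
    moreover have "\<not> N a \<subseteq> insert v (outliers v)"
    proof
      assume sub: "N a \<subseteq> insert v (outliers v)"
      have "u \<notin> N a"
      proof
        assume "u \<in> N a"
        from step_right[OF 1 this] show False
          using no_cycle[OF V(1), of "Suc 2"] k_ge by auto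
      qed
      moreover have "u1 \<notin> N a"
        using no_two_cycle[OF V(4) a] .
      ultimately have "N a \<subseteq> {v}"
        using sub O by auto
      then show False
        using card_N_not_sub_singleton aV by blast
    qed
    ultimately show ?thesis
      using fork_grandchild_position[OF f' a] vn un a O by auto
  qed
  then have eq: "N u1 = N v1"
    using card_N V finite_N by (intro card_subset_eq) auto
  obtain y where y: "y \<noteq> v1" "outliers u = {v1, y}"
    using ex_other_outlier[OF V(1) v1o] by metis
  have yo: "y \<in> outliers u"
    using y by auto
  then have yV: "y \<in> V"
    unfolding outliers_def by auto
  have ny: "y \<notin> L j u1" if "j < k" for j
  proof
    assume "y \<in> L j u1"
    then have "y \<in> L (Suc j) u"
      using u1 by auto
    then show False
      using not_outlier[OF yo, of "Suc j"] that by auto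
  qed
  have nyv: "y \<notin> L j v1" if "j < k" for j
  proof (cases j)
    case 0
    then show ?thesis
      using y by auto
  next
    case (Suc i)
    then show ?thesis
      using ny[OF that] eq by auto
  qed
  show False
  proof -
    have "y \<notin> L 0 u"
      using not_outlier[OF yo, of 0] by auto
    then have "y \<noteq> u" "y \<noteq> u1" "y \<noteq> v"
      using ny[of 0] ny[of "k - 1"] v k_ge by auto
    then have "y \<notin> outliers v"
      using O by auto
    then obtain j where j: "j \<le> k" "y \<in> L j v"
      using yV unfolding outliers_def by auto
    then obtain m where m: "j = Suc m"
      using \<open>y \<noteq> v\<close> by (cases j) auto
    have "y \<in> L m v1 \<or> y \<in> L m w"
      using j m f by (auto simp: fork_def)
    then have "y \<in> L m w"
      using nyv[of m] m j by auto
    then have "y \<in> L j u"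
      using m f by (auto simp: fork_def)
    then show False
      using not_outlier[OF yo] j by auto
  qed
qed

text \<open>\<open>u\<close> has depth \<open>k - 1\<close> below \<open>v1\<close> but not below
  \<open>u1\<close>, which would close a cycle of length \<open>k\<close>. So the out-neighbour of
  \<open>v1\<close> leading to \<open>u\<close> is not one of \<open>u1\<close>: it is the outlier
  \<open>y\<close> of \<open>u\<close> or, for \<open>k = 3\<close>, has out-neighbours
  \<open>u\<close> and \<open>y\<close>.\<close>

lemma no_fork_no_outlier:
  assumes f: "fork u v w u1 v1" and v: "v \<in> L (k - 1) u1" and u: "u \<in> L (k - 1) v1"
  shows False
proof -
  note V = fork_verts[OF f]
  note f' = fork_sym[OF f]
  have u1: "u1 \<in> N u" and v1: "v1 \<in> N v"
    using f by (auto simp: fork_def)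
  have v1o: "v1 \<in> outliers u" and u1o: "u1 \<in> outliers v"
    using fork_child_outlier f f' u v by blast+
  obtain y where y: "y \<noteq> v1" "outliers u = {v1, y}"
    using ex_other_outlier[OF V(1) v1o] by metis
  have un: "u \<notin> N v1"
    using fork_root_not_grandchild[OF f' u] .
  have u_not: "u \<notin> L (k - 1) u1"
  proof
    assume "u \<in> L (k - 1) u1"
    then have "u \<in> L (Suc (k - 1)) u"
      using u1 by auto
    then show False
      using no_cycle[OF V(1), of "Suc (k - 1)"] k_ge by auto
  qed
  have k1: "k - 1 = Suc (k - 2)"
    using k_ge by auto
  have u_via: "\<exists>c \<in> N v1. u \<in> L (k - 2) c"
    using u k1 by auto
  have u_not_via: "u \<notin> L (k - 2) c" if "c \<in> N u1" for c
    using u_not k1 that by auto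
  \<comment> \<open>The last alternative is the deep case of
    \<open>fork_grandchild_position\<close>: \<open>N c\<close> avoids \<open>v1\<close>, so it is
    \<open>{u, y}\<close>; then \<open>u\<close> has depth 2 as well as \<open>k - 1\<close> below
    \<open>v1\<close>.\<close>
  have child: "c \<in> N u1 \<or> c = y \<or> (k = 3 \<and> c \<in> L 2 u1 \<and> N c = {u, y})" if c: "c \<in> N v1" for c
  proof -
    have cV: "c \<in> V"
      using c N_sub V by auto
    have 1: "c \<in> L 2 v"
      using c v1 by (auto simp: numeral_2_eq_2)
    have "c \<noteq> u1"
      using 1 not_outlier[OF u1o, of 2] k_ge by auto
    moreover have "c \<noteq> v1" "v1 \<notin> N c"
      using no_cycle[OF V(5), of 1] no_two_cycle[OF V(5) c] c k_ge by auto
    moreover have "k = 3 \<and> c \<in> L 2 u1 \<and> N c = {u, y}"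
      if deep: "c \<in> L (k - 1) u1" "N c \<subseteq> insert u (outliers u)"
    proof -
      have "N c \<subseteq> {u, y}"
        using deep y \<open>v1 \<notin> N c\<close> by auto
      moreover have "card {u, y} \<le> card (N c)"
        using card_N[OF cV] by (simp add: card_insert_if)
      ultimately have "N c = {u, y}"
        by (intro card_seteq) auto
      moreover from this have "u \<in> L 2 v1"
        using c by (auto simp: numeral_2_eq_2)
      then have "2 = k - 1"
        using layer_le_unique[OF V(5) _ _ _ u, of 2] k_ge by auto
      ultimately show ?thesis
        using deep by auto
    qed
    ultimately show ?thesis
      using fork_grandchild_position[OF f c] un c y by auto
  qed
  show False
  proof (cases "\<exists>c \<in> N v1. k = 3 \<and> c \<in> L 2 u1 \<and> N c = {u, y}")
    case True
    then obtain c where c: "c \<in> N v1" "k = 3" "c \<in> L 2 u1" "N c = {u, y}"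
      by auto
    have cV: "c \<in> V"
      using c N_sub V by auto
    obtain a where a: "a \<in> N u1" "c \<in> N a"
      using c by (auto simp: numeral_2_eq_2)
    have aV: "a \<in> V"
      using a N_sub V by auto
    obtain d where d: "d \<noteq> c" "N v1 = {c, d}"
      using ex_other_child[OF V(5) c(1)] by metis
    have nd: "s \<notin> L 1 d" if "s \<in> L i c" "i < 3" for s i
      using diverge[OF V(5), of c d i 1] d that c by auto
    have "d \<noteq> y"
      using diverge[OF V(5), of c d 1 0] d c by auto
    moreover have "N d \<noteq> {u, y}"
      using nd[of u 1] c by auto
    ultimately have "d \<in> N u1"
      using child[of d] d by auto
    moreover have "d \<noteq> a"
      using nd[of c 0] a by auto
    ultimately have N1: "N u1 = {a, d}"
      using N_eq V a by auto
    \<comment> \<open>An arc from \<open>d\<close> to \<open>v\<close> would close a 3-cycle through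
      \<open>v1\<close>; one from \<open>a\<close> to \<open>v\<close> would give walks of lengths 1
      and 3 from \<open>a\<close> to \<open>c\<close>.\<close>
    have "v \<in> N a \<or> v \<in> N d"
      using v c N1 by (auto simp: numeral_2_eq_2)
    moreover have "v \<notin> N d"
    proof
      assume "v \<in> N d"
      then have "v \<in> L 3 v"
        using d v1 by (auto simp: numeral_3_eq_3)
      then show False
        using no_cycle[OF V(2), of 3] c by auto
    qed
    moreover have "v \<notin> N a"
    proof
      assume "v \<in> N a"
      then have "c \<in> L 3 a"
        using c v1 by (auto simp: numeral_3_eq_3)
      moreover have "c \<in> L 1 a"
        using a by auto
      ultimately show False
        using layer_le_unique[OF aV, of 1 3 c] c by auto
    qed
    ultimately show False
      by auto
  next
    case False
    then have ch: "c \<in> N u1 \<or> c = y" if "c \<in> N v1" for c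
      using child that by blast
    obtain d where d: "d \<in> N v1" "u \<in> L (k - 2) d"
      using u_via by auto
    then have "d = y"
      using ch u_not_via by auto
    then have y1: "y \<in> N v1" "u \<in> L (k - 2) y"
      using d by auto
    obtain a where a: "a \<noteq> y" "N v1 = {y, a}"
      using ex_other_child[OF V(5) y1(1)] by metis
    then have aa: "a \<in> N u1" "a \<in> N v1"
      using ch by auto
    obtain u' x where x: "u' \<in> V" "x \<in> V" "N u' = {x, u1}" "x \<noteq> u1"
      "x \<in> outliers u \<or> N x \<subseteq> insert u (outliers u)" "x \<noteq> v1" "v1 \<notin> N x"
      using fork_other_parent[OF f aa] by metis
    \<comment> \<open>Continuing to \<open>u1\<close> would make the trees below \<open>x\<close>
      and \<open>u1\<close> meet under \<open>u'\<close>. Depths \<open>k - 2\<close> and 1 exclude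
      \<open>x = y\<close> and \<open>u \<in> N x\<close>.\<close>
    have "u \<notin> L j x" if "Suc j < k" for j
    proof
      assume "u \<in> L j x"
      from step_right[OF this u1] have "u1 \<in> L (Suc j) x" .
      moreover have "u1 \<in> L 0 u1"
        by simp
      ultimately show False
        using diverge[OF x(1), of x u1 "Suc j" 0] x that by auto
    qed
    from this[of "k - 2"] this[of 1] have "u \<notin> L (k - 2) x" "u \<notin> L 1 x"
      using k_ge by auto
    then have "x \<noteq> y" "u \<notin> N x"
      using y1 by auto
    then have "N x \<subseteq> {y}"
      using x y by auto
    then show False
      using card_N_not_sub_singleton x by blast
  qed
qed

lemma no_fork: "\<not> fork u v w u1 v1"
proof
  assume f: "fork u v w u1 v1"
  show False
    using fork_root_position[OF f] fork_root_position[OF fork_sym[OF f]]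
      no_fork_mutual_outliers[OF f] no_fork_one_outlier[OF f] no_fork_no_outlier[OF f]
      no_fork_one_outlier[OF fork_sym[OF f]] by blast
qed

section \<open>Twin classes and parity\<close>

lemma common_child_twins:
  assumes "u \<in> V" "v \<in> V" "p \<in> N u" "p \<in> N v"
  shows "N u = N v"
proof (rule ccontr)
  assume ne: "N u \<noteq> N v"
  obtain u1 where u1: "u1 \<noteq> p" "N u = {p, u1}"
    using ex_other_child[OF assms(1) assms(3)] by metis
  obtain v1 where v1: "v1 \<noteq> p" "N v = {p, v1}"
    using ex_other_child[OF assms(2) assms(4)] by metis
  have "fork u v p u1 v1"
    using u1 v1 ne assms by (auto simp: fork_def)
  then show False
    using no_fork by blast
qed

text \<open>A class of equal out-neighbourhoods is the whole in-neighbourhood of any vertex in them,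
  so it has two elements; such classes cannot partition a set of odd order.\<close>

lemma inconsistent: False
proof -
  define cls where "cls u = {x \<in> V. N x = N u}" for u
  have card2: "card (cls u) = 2" if u: "u \<in> V" for u
  proof -
    obtain p where p: "p \<in> N u"
      using card_N[OF u] by fastforce
    then have "cls u = {x \<in> V. p \<in> N x}"
      using common_child_twins u by (auto simp: cls_def)
    then show ?thesis
      using card_parents[of p] p N_sub u by auto
  qed
  have U: "\<Union> (cls ` V) = V"
    by (auto simp: cls_def)
  have "2 * card (cls ` V) = card (\<Union> (cls ` V))"
  proof (rule card_partition)
    show "c1 \<inter> c2 = {}" if "c1 \<in> cls ` V" "c2 \<in> cls ` V" "c1 \<noteq> c2" for c1 c2
      using that by (auto simp: cls_def)
  qed (use card2 finite_V U in auto)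
  then have "2 * card (cls ` V) = 2 ^ (k + 1) + 1"
    using U card_V by simp
  moreover have "even (2 * card (cls ` V))" "odd (2 ^ (k + 1) + 1 :: nat)"
    by simp_all
  ultimately show False
    by simp
qed

end

section \<open>Transfer from arc walks to layers\<close>

lemma (in wf_digraph) mem_layer_iff_awalk:
  assumes "x \<in> verts G"
  shows "y \<in> layer (\<lambda>v. head G ` out_arcs G v) n x \<longleftrightarrow> (\<exists>p. awalk x p y \<and> length p = n)"
  using assms
proof (induction n arbitrary: x)
  case 0
  then show ?case
    by (auto simp: awalk_Nil_iff)
next
  case (Suc n)
  have "y \<in> layer (\<lambda>v. head G ` out_arcs G v) (Suc n) x \<longleftrightarrow>
    (\<exists>e \<in> out_arcs G x. \<exists>p. awalk (head G e) p y \<and> length p = n)"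
    using Suc.IH by auto
  also have "\<dots> \<longleftrightarrow> (\<exists>p. awalk x p y \<and> length p = Suc n)"
    (is "?L \<longleftrightarrow> ?R")
  proof
    assume ?L
    then obtain e p where "e \<in> out_arcs G x" "awalk (head G e) p y" "length p = n"
      by auto
    then show ?R
      by (intro exI[of _ "e # p"]) (simp add: awalk_Cons_iff)
  next
    assume ?R
    then obtain e p where "awalk x (e # p) y" "length p = n"
      by (auto simp: length_Suc_conv)
    then show ?L
      by (intro bexI[of _ e] exI[of _ p]) (simp_all add: awalk_Cons_iff)
  qed
  finally show ?case .
qed

lemma geodetic_excess_two_if_diregular:
  assumes "3 \<le> k" "excess_digraph 2 k 2 G" "diregular 2 G"
  shows "geodetic_excess_two (verts G) (\<lambda>v. head G ` out_arcs G v) k"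
proof -
  interpret fin_digraph G
    using assms by (simp add: excess_digraph_def)
  let ?N = "\<lambda>v. head G ` out_arcs G v"
  have geo: "p = q" if "x \<in> verts G" "awalk x p y" "length p \<le> k" "awalk x q y" "length q \<le> k"
    for x y p q
    using assms(2) that awalk_last_in_verts[OF that(2)]
    unfolding excess_digraph_def k_geodetic_def by blast
  \<comment> \<open>Parallel arcs would be two walks of length 1. Hence degrees count
    neighbours.\<close>
  have inj_arc: "e = e'" if "e \<in> arcs G" "e' \<in> arcs G" "tail G e = tail G e'" "head G e = head G e'"
    for e e'
    using geo[of "tail G e" "[e]" "head G e" "[e']"] that assms(1)
    by (auto simp: awalk_Cons_iff awalk_Nil_iff)
  have deg: "card (in_arcs G v) = 2" "card (out_arcs G v) = 2" if "v \<in> verts G" for v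
    using assms(3) that by (auto simp: diregular_def in_degree_def out_degree_def)
  show ?thesis
  proof
    fix x assume x: "x \<in> verts G"
    have "inj_on (head G) (out_arcs G x)"
      using inj_arc by (auto simp: inj_on_def)
    then show "card (?N x) = 2"
      using deg[OF x] card_image by metis
    have "{u \<in> verts G. x \<in> ?N u} = tail G ` in_arcs G x"
      by (auto simp: image_iff)
    moreover have "inj_on (tail G) (in_arcs G x)"
      using inj_arc by (auto simp: inj_on_def)
    ultimately show "card {u \<in> verts G. x \<in> ?N u} = 2"
      using deg[OF x] card_image by metis
  next
    fix x j assume x: "x \<in> verts G" and j: "0 < j" "j \<le> k"
    show "x \<notin> layer ?N j x"
      using geo[OF x, of "[]" x] mem_layer_iff_awalk[OF x] x j by (auto simp: awalk_Nil_iff)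
  next
    fix x p q i j
    assume x: "x \<in> verts G" and pq: "p \<in> ?N x" "q \<in> ?N x" "p \<noteq> q" and ij: "i < k" "j < k"
    obtain e e' where e: "e \<in> out_arcs G x" "head G e = p" "e' \<in> out_arcs G x" "head G e' = q"
      using pq by auto
    then have V: "p \<in> verts G" "q \<in> verts G"
      by auto
    show "layer ?N i p \<inter> layer ?N j q = {}"
    proof (rule ccontr)
      assume "\<not> ?thesis"
      then obtain y a b where "awalk p a y" "length a = i" "awalk q b y" "length b = j"
        using mem_layer_iff_awalk V by blast
      \<comment> \<open>The lists start with different arcs, and \<open>i\<close>, \<open>j\<close>
        below \<open>k\<close> leave room for that first arc.\<close>
      then have "e # a = e' # b"
        using e ij by (intro geo[OF x, of _ y]) (auto simp: awalk_Cons_iff)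
      then show False
        using e pq by auto
    qed
  next
    have "(\<Sum>i = 0..k. 2 ^ i) + 2 = (2::nat) ^ (k + 1) + 1"
      by (induction k) auto
    then show "card (verts G) = 2 ^ (k + 1) + 1"
      using assms(2) by (simp add: excess_digraph_def moore_bound_def)
  qed (use assms(1) in auto)
qed

theorem theorem2:
  fixes k :: nat
  assumes "k \<ge> 3"
  shows "\<not> (\<exists>G :: ('a, 'b) pre_digraph. excess_digraph 2 k 2 G \<and> diregular 2 G)"
  using geodetic_excess_two_if_diregular[OF assms] geodetic_excess_two.inconsistent by blast

end
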